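(* Let $L$ be a finite loop and let $d\ge 2$ be an integer. Every pair $(\Psi,\Phi)\in\mathcal{C}^2_\delta(L)$ has a unique representation \[(\Psi,\Phi)=(\psi+\delta_f,\ \psi+\nu_f)\quad\text{with } (\psi,f)\in\mathcal{Z}^2(L)\times\mathcal{C}^1(L).\] Moreover, for this representation, \[H_{\psi+\delta_f,\psi+\nu_f,d}[a_1,\ldots,a_d]=H_{\psi,\psi,d}[a_1,\ldots,a_d]\prod_{j=1}^d(-1)^{f(a_j)}\] for all $a_1,\ldots,a_d\in L$. Consequently, the arrays $H_{\psi+\delta_f,\psi+\nu_f,d}$ and $H_{\psi,\psi,d}$ are equivalent under multidimensional Hadamard equivalence.
   Context: A loop is a set $L$ with a binary operation (written by juxtaposition, not necessarily associative) having an identity element $e$ and such that for all $a,b\in L$ the equations $ax=b$ and $ya=b$ have unique solutions $x,y\in L$. $\mathcal{C}^k(L)$ is the set of all functions $L^k\to\mathbb{Z}_2$, with pointwise addition. $\mathcal{Z}^2(L)$ is the set of $2$-cocycles: $\psi\in\mathcal{C}^2(L)$ with $\psi(a,b)+\psi(ab,c)=\psi(a,bc)+\psi(b,c)$ for all $a,b,c\in L$. $\mathcal{C}^2_\delta(L)$ is the set of $\delta$-compatible pairs, i.e. pairs $(\psi,\phi)\in\mathcal{C}^2(L)\times\mathcal{C}^2(L)$ with $\psi(a,b)+\phi(ab,c)=\phi(a,bc)+\psi(b,c)$ for all $a,b,c\in L$. For $f\in\mathcal{C}^1(L)$: $\delta_f(a,b):=f(a)+f(b)+f(ab)$ and $\nu_f(a,b):=f(a)+f(b)$.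 For $\psi\in\mathcal{C}^2(L)$, $M_\psi[a,b]:=(-1)^{\psi(a,b)}$. For $\psi,\phi\in\mathcal{C}^2(L)$ and $d\ge2$, the array $H_{\psi,\phi,d}:L^d\to\{\pm1\}$ is \[H_{\psi,\phi,d}[a_1,\ldots,a_d]:=\left(\prod_{i=2}^{d-1} M_\psi[p_{i-1},a_i]\right)\cdot M_{\phi}[p_{d-1},a_d],\] where $p_1:=a_1$ and $p_i:=p_{i-1}a_i$ for $2\le i<d$ (an empty product is $1$). Two $d$-dimensional $\pm1$ arrays $H,H'$ indexed by $L^d$ are (multidimensionally) Hadamard equivalent if there exist, for each $i\in\{1,\ldots,d\}$, a permutation $\pi_i$ of $L$ and a function $\epsilon_i:L\to\{\pm1\}$ such that $H'[a_1,\ldots,a_d]=\left(\prod_{i=1}^d\epsilon_i(a_i)\right)H[\pi_1(a_1),\ldots,\pi_d(a_d)]$ for all $a_1,\ldots,a_d\in L$. *)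

theory Defs
  imports "HOL-Algebra.Group" "HOL-Library.Z2"
begin

text \<open>
  A loop is represented by the carrier, multiplication and unit fields of the
  HOL-Algebra record \<^type>\<open>monoid_ext\<close>; associativity is not assumed.
\<close>

locale loop =
  fixes L :: "('a, 'b) monoid_scheme" (structure)
  assumes mult_closed: "\<lbrakk>x \<in> carrier L; y \<in> carrier L\<rbrakk> \<Longrightarrow> x \<otimes> y \<in> carrier L"
    and one_closed: "\<one> \<in> carrier L"
    and left_one: "x \<in> carrier L \<Longrightarrow> \<one> \<otimes> x = x"
    and right_one: "x \<in> carrier L \<Longrightarrow> x \<otimes> \<one> = x"
    and left_division:
      "\<lbrakk>a \<in> carrier L; b \<in> carrier L\<rbrakk> \<Longrightarrow> \<exists>!x. x \<in> carrier L \<and> a \<otimes> x = b"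
    and right_division:
      "\<lbrakk>a \<in> carrier L; b \<in> carrier L\<rbrakk> \<Longrightarrow> \<exists>!y. y \<in> carrier L \<and> y \<otimes> a = b"

text \<open>
  Functions on $L^k$ are taken to be extensional (equal to \<^const>\<open>undefined\<close> off the
  carrier), so that equality in HOL is equality of functions on $L^k$.  The two-element
  field is \<^typ>\<open>bit\<close>.
\<close>

definition cochains1 :: "('a, 'b) monoid_scheme \<Rightarrow> ('a \<Rightarrow> bit) set"
  where "cochains1 L = carrier L \<rightarrow>\<^sub>E UNIV"

definition cochains2 :: "('a, 'b) monoid_scheme \<Rightarrow> ('a \<times> 'a \<Rightarrow> bit) set"
  where "cochains2 L = carrier L \<times> carrier L \<rightarrow>\<^sub>E UNIV"

definition add_cochain2 ::
    "('a, 'b) monoid_scheme \<Rightarrow> ('a \<times> 'a \<Rightarrow> bit) \<Rightarrow> ('a \<times> 'a \<Rightarrow> bit) \<Rightarrow> 'a \<times> 'a \<Rightarrow> bit"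
    (infixl \<open>\<oplus>\<^sub>2\<index>\<close> 65)
  where "\<psi> \<oplus>\<^sub>2\<^bsub>L\<^esub> \<phi> = restrict (\<lambda>x. \<psi> x + \<phi> x) (carrier L \<times> carrier L)"

definition cocycles2 :: "('a, 'b) monoid_scheme \<Rightarrow> ('a \<times> 'a \<Rightarrow> bit) set"
  where "cocycles2 L = {\<psi> \<in> cochains2 L.
    \<forall>a\<in>carrier L. \<forall>b\<in>carrier L. \<forall>c\<in>carrier L.
      \<psi> (a, b) + \<psi> (a \<otimes>\<^bsub>L\<^esub> b, c) = \<psi> (a, b \<otimes>\<^bsub>L\<^esub> c) + \<psi> (b, c)}"

definition delta_compatible ::
    "('a, 'b) monoid_scheme \<Rightarrow> (('a \<times> 'a \<Rightarrow> bit) \<times> ('a \<times> 'a \<Rightarrow> bit)) set"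
  where "delta_compatible L = {(\<psi>, \<phi>) \<in> cochains2 L \<times> cochains2 L.
    \<forall>a\<in>carrier L. \<forall>b\<in>carrier L. \<forall>c\<in>carrier L.
      \<psi> (a, b) + \<phi> (a \<otimes>\<^bsub>L\<^esub> b, c) = \<phi> (a, b \<otimes>\<^bsub>L\<^esub> c) + \<psi> (b, c)}"

definition delta :: "('a, 'b) monoid_scheme \<Rightarrow> ('a \<Rightarrow> bit) \<Rightarrow> 'a \<times> 'a \<Rightarrow> bit"
    (\<open>\<delta>\<index>\<close>)
  where "\<delta>\<^bsub>L\<^esub> f = restrict (\<lambda>(a, b). f a + f b + f (a \<otimes>\<^bsub>L\<^esub> b)) (carrier L \<times> carrier L)"

definition nu :: "('a, 'b) monoid_scheme \<Rightarrow> ('a \<Rightarrow> bit) \<Rightarrow> 'a \<times> 'a \<Rightarrow> bit"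
    (\<open>\<nu>\<index>\<close>)
  where "\<nu>\<^bsub>L\<^esub> f = restrict (\<lambda>(a, b). f a + f b) (carrier L \<times> carrier L)"

text \<open>$(-1)^x$ for $x$ in the two-element field.\<close>

definition neg_one_pow :: "bit \<Rightarrow> int"
  where "neg_one_pow x = (if x = 0 then 1 else - 1)"

definition sign_matrix :: "('a \<times> 'a \<Rightarrow> bit) \<Rightarrow> 'a \<Rightarrow> 'a \<Rightarrow> int"
  where "sign_matrix \<psi> a b = neg_one_pow (\<psi> (a, b))"

text \<open>$L^d$, with coordinates numbered from $1$ to $d$.\<close>

definition tuples :: "('a, 'b) monoid_scheme \<Rightarrow> nat \<Rightarrow> (nat \<Rightarrow> 'a) set"
  where "tuples L d = {1..d} \<rightarrow>\<^sub>E carrier L"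

text \<open>
  The left-normed product $p_i = (\cdots((a_1 a_2) a_3) \cdots) a_i$; only $i \ge 1$ is
  meaningful.
\<close>

primrec left_prod :: "('a, 'b) monoid_scheme \<Rightarrow> (nat \<Rightarrow> 'a) \<Rightarrow> nat \<Rightarrow> 'a"
  where
    "left_prod L a 0 = \<one>\<^bsub>L\<^esub>"
  | "left_prod L a (Suc i) = (if i = 0 then a 1 else left_prod L a i \<otimes>\<^bsub>L\<^esub> a (Suc i))"

definition sign_arrays :: "('a, 'b) monoid_scheme \<Rightarrow> nat \<Rightarrow> ((nat \<Rightarrow> 'a) \<Rightarrow> int) set"
  where "sign_arrays L d = tuples L d \<rightarrow>\<^sub>E {1, - 1}"

definition H_array ::
    "('a, 'b) monoid_scheme \<Rightarrow> ('a \<times> 'a \<Rightarrow> bit) \<Rightarrow> ('a \<times> 'a \<Rightarrow> bit) \<Rightarrow> nat \<Rightarrow> (nat \<Rightarrow> 'a) \<Rightarrow> int"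
  where "H_array L \<psi> \<phi> d =
    restrict (\<lambda>a. (\<Prod>i = 2..d - 1. sign_matrix \<psi> (left_prod L a (i - 1)) (a i)) *
                  sign_matrix \<phi> (left_prod L a (d - 1)) (a d)) (tuples L d)"

definition hadamard_equivalent ::
    "('a, 'b) monoid_scheme \<Rightarrow> nat \<Rightarrow> ((nat \<Rightarrow> 'a) \<Rightarrow> int) \<Rightarrow> ((nat \<Rightarrow> 'a) \<Rightarrow> int) \<Rightarrow> bool"
  where "hadamard_equivalent L d H H' \<longleftrightarrow>
    H \<in> sign_arrays L d \<and> H' \<in> sign_arrays L d \<and>
    (\<exists>(\<pi> :: nat \<Rightarrow> 'a \<Rightarrow> 'a) (\<epsilon> :: nat \<Rightarrow> 'a \<Rightarrow> int).
      (\<forall>i\<in>{1..d}. bij_betw (\<pi> i) (carrier L) (carrier L)) \<and>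
      (\<forall>i\<in>{1..d}. \<forall>x\<in>carrier L. \<epsilon> i x \<in> {1, - 1}) \<and>
      (\<forall>a\<in>tuples L d.
        H' a = (\<Prod>i = 1..d. \<epsilon> i (a i)) * H (restrict (\<lambda>i. \<pi> i (a i)) {1..d})))"

end

(*
  Specialising the compatibility equation to b = 1 shows that \<Psi>(a,1) = \<Psi>(1,c) is a
  constant k, and specialising it to a = 1 then gives \<Psi>(b,c) + \<Phi>(b,c) = \<Phi>(1,bc) + k, a
  function f of the product bc alone.  This forces f, and \<psi> = \<Phi> + \<nu>_f.  In H, the terms
  f(p_i) contributed by consecutive factors \<delta>_f(p_(i-1),a_i) cancel in pairs, the last one
  against the f(p_(d-1)) in \<nu>_f(p_(d-1),a_d).
*)
theory Submission
  imports Defs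
begin

lemma neg_one_pow_square: "neg_one_pow x * neg_one_pow x = 1"
  by (simp add: neg_one_pow_def)

lemma neg_one_pow_sign: "neg_one_pow x \<in> {1, - 1}"
  by (simp add: neg_one_pow_def)

text \<open>The induction also covers infinite \<open>A\<close>, where \<open>prod\<close> has its
  default value 1.\<close>

lemma prod_sign:
  assumes "\<And>i. i \<in> A \<Longrightarrow> g i \<in> {1, - 1 :: int}"
  shows "prod g A \<in> {1, - 1}"
  using assms by (induction A rule: infinite_finite_induct) (simp, simp, fastforce)

lemma (in loop) left_prod_closed:
  assumes "a \<in> tuples L d" "1 \<le> n" "n \<le> d"
  shows "left_prod L a n \<in> carrier L"
  using assms(2,3)
proof (induction n rule: dec_induct)
  case base
  then show ?case using assms(1) by (auto simp: tuples_def)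
next
  case (step n)
  then have "a (Suc n) \<in> carrier L" using assms(1) by (auto simp: tuples_def)
  with step show ?case by (simp add: mult_closed)
qed

lemma sign_matrix_add_delta:
  assumes "x \<in> carrier L" "y \<in> carrier L"
  shows "sign_matrix (\<psi> \<oplus>\<^sub>2\<^bsub>L\<^esub> \<delta>\<^bsub>L\<^esub> f) x y =
    sign_matrix \<psi> x y * neg_one_pow (f x) * neg_one_pow (f y) * neg_one_pow (f (x \<otimes>\<^bsub>L\<^esub> y))"
  using assms by (simp add: sign_matrix_def add_cochain2_def delta_def neg_one_pow_def)

lemma sign_matrix_add_nu:
  assumes "x \<in> carrier L" "y \<in> carrier L"
  shows "sign_matrix (\<psi> \<oplus>\<^sub>2\<^bsub>L\<^esub> \<nu>\<^bsub>L\<^esub> f) x y =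
    sign_matrix \<psi> x y * neg_one_pow (f x) * neg_one_pow (f y)"
  using assms by (simp add: sign_matrix_def add_cochain2_def nu_def neg_one_pow_def)

text \<open>Telescoping: the factor at i carries the signs of f at p_(i-1), a_i and p_i, and the
  sign at p_i returns in the factor at i + 1. Only the sign at p_n stays unpaired at the upper
  end.\<close>

lemma (in loop) prod_sign_matrix_add_delta:
  assumes a: "a \<in> tuples L d" and "1 \<le> n" "n \<le> d"
  shows "(\<Prod>i = 2..n. sign_matrix (\<psi> \<oplus>\<^sub>2 \<delta> f) (left_prod L a (i - 1)) (a i)) =
    (\<Prod>i = 2..n. sign_matrix \<psi> (left_prod L a (i - 1)) (a i)) *
    (\<Prod>j = 1..n. neg_one_pow (f (a j))) * neg_one_pow (f (left_prod L a n))"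
  using assms(2,3)
proof (induction n rule: dec_induct)
  case base
  \<comment> \<open>For n = 1 the matrix products are empty. As p_1 = a_1, the factor for j = 1 and
    the boundary sign are the same sign, and their product is 1.\<close>
  show ?case by (simp add: neg_one_pow_square)
next
  case (step n)
  let ?p = "left_prod L a n" and ?s = "neg_one_pow (f (left_prod L a n))"
  have "?p \<in> carrier L" using left_prod_closed[OF a] step by simp
  moreover have "a (Suc n) \<in> carrier L" using a step by (auto simp: tuples_def)
  ultimately have "sign_matrix (\<psi> \<oplus>\<^sub>2 \<delta> f) ?p (a (Suc n)) =
      sign_matrix \<psi> ?p (a (Suc n)) * ?s * neg_one_pow (f (a (Suc n))) *
      neg_one_pow (f (left_prod L a (Suc n)))"
    using step(1) by (simp add: sign_matrix_add_delta)
  \<comment> \<open>\<open>1 \<le> n\<close> ensures that \<open>{2..Suc n}\<close> has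
    \<open>Suc n\<close> as its last index.\<close>
  moreover have "prod g {2..Suc n} = prod g {2..n} * g (Suc n)"
      "prod g {1..Suc n} = prod g {1..n} * g (Suc n)" for g :: "nat \<Rightarrow> int"
    using step(1) by simp_all
  \<comment> \<open>The sign at p_n left by the induction hypothesis meets the one in the new
    factor; v is the new boundary sign. The bracketing is the one produced by the rewriting that
    follows.\<close>
  moreover have "x * y * ?s * (z * ?s * u * v) = x * z * (y * u) * v" for x y z u v
    by (simp add: neg_one_pow_def)
  ultimately show ?case
    using step.IH[OF Suc_leD[OF step.prems]] by (simp only: diff_Suc_1)
qed

text \<open>The \<delta> factors leave the single sign at p_(d-1). The last factor cancels it and,
  since \<nu> has no term at the product of its arguments, leaves no sign at p_d.\<close>

lemma (in loop) H_array_add_delta_nu: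
  assumes "d \<ge> 2" and a: "a \<in> tuples L d"
  shows "H_array L (\<psi> \<oplus>\<^sub>2 \<delta> f) (\<psi> \<oplus>\<^sub>2 \<nu> f) d a =
    H_array L \<psi> \<psi> d a * (\<Prod>j = 1..d. neg_one_pow (f (a j)))"
proof -
  obtain n where d: "d = Suc n" and n: "1 \<le> n" using assms(1) by (cases d) auto
  let ?p = "left_prod L a n" and ?s = "neg_one_pow (f (left_prod L a n))"
  have "?p \<in> carrier L" using left_prod_closed[OF a] n d by simp
  moreover have "a d \<in> carrier L" using a d by (auto simp: tuples_def)
  ultimately have "sign_matrix (\<psi> \<oplus>\<^sub>2 \<nu> f) ?p (a d) =
      sign_matrix \<psi> ?p (a d) * ?s * neg_one_pow (f (a d))"
    by (rule sign_matrix_add_nu)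
  moreover have "H_array L \<psi>' \<phi>' d a =
      (\<Prod>i = 2..n. sign_matrix \<psi>' (left_prod L a (i - 1)) (a i)) * sign_matrix \<phi>' ?p (a d)"
    for \<psi>' \<phi>'
    using a d by (simp add: H_array_def)
  moreover have "(\<Prod>j = 1..d. g j) = (\<Prod>j = 1..n. g j) * g d" for g :: "nat \<Rightarrow> int"
    using d by simp
  moreover have "x * y * ?s * (z * ?s * u) = x * z * (y * u)" for x y z u
    by (simp add: neg_one_pow_def)
  ultimately show ?thesis
    using prod_sign_matrix_add_delta[OF a n, of \<psi> f] d by (simp only: le_SucI le_refl)
qed

text \<open>Equivalence is declared only between arrays with values 1 and -1; this supplies that
  condition for both arrays.\<close>

lemma H_array_sign: "H_array L \<psi> \<phi> d \<in> sign_arrays L d"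
proof -
  have "x * y \<in> {1, - 1}" if "x \<in> {1, - 1}" "y \<in> {1, - 1}" for x y :: int
    using that by auto
  then show ?thesis
    unfolding sign_arrays_def H_array_def restrict_PiE_iff sign_matrix_def
    by (intro ballI) (simp only: prod_sign neg_one_pow_sign)
qed

text \<open>The witnesses are the identity permutation and the sign (-1)^f in every
  coordinate.\<close>

lemma (in loop) hadamard_equivalent_add_delta_nu:
  assumes "d \<ge> 2"
  shows "hadamard_equivalent L d (H_array L (\<psi> \<oplus>\<^sub>2 \<delta> f) (\<psi> \<oplus>\<^sub>2 \<nu> f) d) (H_array L \<psi> \<psi> d)"
proof -
  let ?H = "H_array L (\<psi> \<oplus>\<^sub>2 \<delta> f) (\<psi> \<oplus>\<^sub>2 \<nu> f) d"
  have "H_array L \<psi> \<psi> d a =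
      (\<Prod>i = 1..d. neg_one_pow (f (a i))) * ?H (restrict (\<lambda>i. id (a i)) {1..d})"
    if a: "a \<in> tuples L d" for a
  proof -
    let ?q = "\<Prod>i = 1..d. neg_one_pow (f (a i))"
    have "restrict (\<lambda>i. id (a i)) {1..d} = a"
      using a by (simp add: tuples_def PiE_restrict)
    \<comment> \<open>The array identity is to be solved for the array of \<psi>; a product of signs
      is its own inverse.\<close>
    moreover have "?q * ?q = 1"
      by (simp add: prod.distrib[symmetric] neg_one_pow_square)
    ultimately show ?thesis
      using H_array_add_delta_nu[OF assms a, of \<psi> f] by (simp add: ac_simps)
  qed
  moreover have "neg_one_pow (f x) \<in> {1, - 1}" for x
    by (rule neg_one_pow_sign)
  ultimately show ?thesis
    unfolding hadamard_equivalent_def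
    by (intro conjI H_array_sign exI[where x = "\<lambda>_. id"]
        exI[where x = "\<lambda>_ x. neg_one_pow (f x)"]) auto
qed

lemma (in loop) delta_compatible_add:
  assumes "(\<Psi>, \<Phi>) \<in> delta_compatible L" and b: "b \<in> carrier L" and c: "c \<in> carrier L"
  shows "\<Psi> (b, c) + \<Phi> (b, c) = \<Phi> (\<one>, b \<otimes> c) + \<Psi> (\<one>, \<one>)"
proof -
  have comp: "\<Psi> (x, y) + \<Phi> (x \<otimes> y, z) = \<Phi> (x, y \<otimes> z) + \<Psi> (y, z)"
    if "x \<in> carrier L" "y \<in> carrier L" "z \<in> carrier L" for x y z
    using assms(1) that by (auto simp: delta_compatible_def)
  \<comment> \<open>Compatibility at (1, 1, b) has \<Phi>(1, b) on both sides. The constant k is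
    thus taken to be \<Psi>(1, 1).\<close>
  have "\<Psi> (\<one>, b) = \<Psi> (\<one>, \<one>)"
    using comp[OF one_closed one_closed b]
    unfolding left_one[OF b] left_one[OF one_closed] by (metis add.commute add_left_cancel)
  moreover have "\<Psi> (\<one>, b) + \<Phi> (b, c) = \<Phi> (\<one>, b \<otimes> c) + \<Psi> (b, c)"
    using comp[OF one_closed b c] b by (simp add: left_one)
  \<comment> \<open>In characteristic 2, terms change sides without a change of sign.\<close>
  moreover have "x + y = z + w \<Longrightarrow> w + y = z + x" for x y z w :: bit
    by (cases x; cases y; cases z; cases w) simp_all
  ultimately show ?thesis by metis
qed

lemma (in loop) delta_compatible_ex:
  assumes "(\<Psi>, \<Phi>) \<in> delta_compatible L"
  obtains \<psi> f where "\<psi> \<in> cocycles2 L" "f \<in> cochains1 L" "\<Psi> = \<psi> \<oplus>\<^sub>2 \<delta> f" "\<Phi> = \<psi> \<oplus>\<^sub>2 \<nu> f"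
proof
  \<comment> \<open>The \<psi> parts of a representation cancel in \<Psi> + \<Phi>, leaving
    \<delta>_f + \<nu>_f, which is f(bc) at (b, c). So f must be the function of bc found in
    \<open>delta_compatible_add\<close>.\<close>
  define f where "f = restrict (\<lambda>x. \<Phi> (\<one>, x) + \<Psi> (\<one>, \<one>)) (carrier L)"
  define \<psi> where "\<psi> = \<Phi> \<oplus>\<^sub>2 \<nu> f"
  have ext: "\<Psi> \<in> extensional (carrier L \<times> carrier L)" "\<Phi> \<in> extensional (carrier L \<times> carrier L)"
    using assms by (auto simp: delta_compatible_def cochains2_def PiE_def)
  have comp: "\<Psi> (a, b) + \<Phi> (a \<otimes> b, c) = \<Phi> (a, b \<otimes> c) + \<Psi> (b, c)"
    if "a \<in> carrier L" "b \<in> carrier L" "c \<in> carrier L" for a b c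
    using assms that by (auto simp: delta_compatible_def)
  have \<Psi>: "\<Psi> (b, c) = \<Phi> (b, c) + f (b \<otimes> c)" if "b \<in> carrier L" "c \<in> carrier L" for b c
  proof -
    have "\<Psi> (b, c) + \<Phi> (b, c) = f (b \<otimes> c)"
      using delta_compatible_add[OF assms that] that by (simp add: f_def mult_closed)
    moreover have "x + y = z \<Longrightarrow> x = y + z" for x y z :: bit
      by (cases x; cases y; cases z) simp_all
    ultimately show ?thesis by blast
  qed
  have \<psi>: "\<psi> (b, c) = \<Phi> (b, c) + (f b + f c)" if "b \<in> carrier L" "c \<in> carrier L" for b c
    using that by (simp add: \<psi>_def add_cochain2_def nu_def)
  have "\<psi> (a, b) + \<psi> (a \<otimes> b, c) = \<psi> (a, b \<otimes> c) + \<psi> (b, c)"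
    if "a \<in> carrier L" "b \<in> carrier L" "c \<in> carrier L" for a b c
  proof -
    \<comment> \<open>Each side of the cocycle equation is the matching side of the compatibility
      equation plus f(a) + f(b) + f(c): the extra f(ab) or f(bc) turns one \<Phi> into \<Psi>. Only
      reordering is involved, so sums are kept from being rewritten to xor.\<close>
    have "(\<psi> (a, b) + \<psi> (a \<otimes> b, c)) =
        (\<Psi> (a, b) + \<Phi> (a \<otimes> b, c)) + (f a + f b + f c)"
      using that by (simp add: \<psi> \<Psi> mult_closed add_ac del: add_bit_eq_xor)
    also have "\<dots> = (\<Phi> (a, b \<otimes> c) + \<Psi> (b, c)) + (f a + f b + f c)"
      by (simp only: comp[OF that])
    also have "\<dots> = \<psi> (a, b \<otimes> c) + \<psi> (b, c)"
      using that by (simp add: \<psi> \<Psi> mult_closed add_ac del: add_bit_eq_xor)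
    finally show ?thesis .
  qed
  moreover have "\<psi> \<in> cochains2 L"
    by (simp add: \<psi>_def add_cochain2_def cochains2_def)
  ultimately show "\<psi> \<in> cocycles2 L" by (simp add: cocycles2_def)
  show "f \<in> cochains1 L" by (simp add: f_def cochains1_def)
  \<comment> \<open>Here p is \<Phi>(a, b), x and y are f(a) and f(b), and z is f(ab); adding
    \<nu>_f a second time undoes the first.\<close>
  have cancel1: "p + (x + y) + (x + y + z) = p + z" for p x y z :: bit
    by (cases p; cases x; cases y; cases z) simp_all
  have cancel2: "p + (x + y) + (x + y) = p" for p x y :: bit
    by (cases p; cases x; cases y) simp_all
  show "\<Psi> = \<psi> \<oplus>\<^sub>2 \<delta> f"
  proof (rule extensionalityI[OF ext(1)])
    show "\<psi> \<oplus>\<^sub>2 \<delta> f \<in> extensional (carrier L \<times> carrier L)"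
      by (simp add: add_cochain2_def)
    fix x assume "x \<in> carrier L \<times> carrier L"
    then obtain a b where x: "x = (a, b)" and ab: "a \<in> carrier L" "b \<in> carrier L" by blast
    have "(\<psi> \<oplus>\<^sub>2 \<delta> f) (a, b) = \<psi> (a, b) + (f a + f b + f (a \<otimes> b))"
      using ab by (simp add: add_cochain2_def delta_def)
    then show "\<Psi> x = (\<psi> \<oplus>\<^sub>2 \<delta> f) x"
      by (simp only: x \<psi>[OF ab] \<Psi>[OF ab] cancel1)
  qed
  show "\<Phi> = \<psi> \<oplus>\<^sub>2 \<nu> f"
  proof (rule extensionalityI[OF ext(2)])
    show "\<psi> \<oplus>\<^sub>2 \<nu> f \<in> extensional (carrier L \<times> carrier L)"
      by (simp add: add_cochain2_def)
    fix x assume "x \<in> carrier L \<times> carrier L"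
    then obtain a b where x: "x = (a, b)" and ab: "a \<in> carrier L" "b \<in> carrier L" by blast
    have "(\<psi> \<oplus>\<^sub>2 \<nu> f) (a, b) = \<psi> (a, b) + (f a + f b)"
      using ab by (simp add: add_cochain2_def nu_def)
    then show "\<Phi> x = (\<psi> \<oplus>\<^sub>2 \<nu> f) x"
      by (simp only: x \<psi>[OF ab] cancel2)
  qed
qed

lemma (in loop) delta_nu_inj:
  assumes "\<psi> \<in> cocycles2 L" "\<psi>' \<in> cocycles2 L" "f \<in> cochains1 L" "f' \<in> cochains1 L"
    and \<delta>: "\<psi> \<oplus>\<^sub>2 \<delta> f = \<psi>' \<oplus>\<^sub>2 \<delta> f'" and \<nu>: "\<psi> \<oplus>\<^sub>2 \<nu> f = \<psi>' \<oplus>\<^sub>2 \<nu> f'"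
  shows "\<psi> = \<psi>' \<and> f = f'"
proof
  have \<nu>_eq: "\<psi> (a, b) + (f a + f b) = \<psi>' (a, b) + (f' a + f' b)"
    if "a \<in> carrier L" "b \<in> carrier L" for a b
    using fun_cong[OF \<nu>, of "(a, b)"] that by (simp add: add_cochain2_def nu_def)
  \<comment> \<open>Bracketed so that each side begins with the corresponding side of
    \<open>\<nu>_eq\<close>.\<close>
  have \<delta>_eq: "\<psi> (a, b) + (f a + f b) + f (a \<otimes> b) = \<psi>' (a, b) + (f' a + f' b) + f' (a \<otimes> b)"
    if "a \<in> carrier L" "b \<in> carrier L" for a b
    using fun_cong[OF \<delta>, of "(a, b)"] that
    by (simp add: add_cochain2_def delta_def add.assoc del: add_bit_eq_xor)
  show f: "f = f'"
  proof (rule extensionalityI)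
    fix x assume x: "x \<in> carrier L"
    \<comment> \<open>At (x, 1) the product is x, so cancelling the \<nu> equation from the \<delta>
      equation leaves f(x) = f'(x).\<close>
    show "f x = f' x"
      using \<nu>_eq[OF x one_closed] \<delta>_eq[OF x one_closed] x
      by (metis right_one add_left_cancel)
  qed (use assms in \<open>auto simp: cochains1_def PiE_def\<close>)
  show "\<psi> = \<psi>'"
  proof (rule extensionalityI)
    fix x assume "x \<in> carrier L \<times> carrier L"
    \<comment> \<open>With f = f' the \<nu> terms agree and cancel.\<close>
    then show "\<psi> x = \<psi>' x"
      using \<nu>_eq f by (auto simp del: add_bit_eq_xor)
  qed (use assms in \<open>auto simp: cocycles2_def cochains2_def PiE_def\<close>)
qed

theorem mainTheorem3:
  fixes L :: "('a, 'b) monoid_scheme" (structure)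
    and d :: nat
    and \<Psi> \<Phi> :: "'a \<times> 'a \<Rightarrow> bit"
  assumes "loop L"
    and "finite (carrier L)"
    and "d \<ge> 2"
    and "(\<Psi>, \<Phi>) \<in> delta_compatible L"
  shows "(\<exists>!(\<psi>, f). (\<psi>, f) \<in> cocycles2 L \<times> cochains1 L \<and>
            (\<Psi>, \<Phi>) = (\<psi> \<oplus>\<^sub>2 \<delta> f, \<psi> \<oplus>\<^sub>2 \<nu> f)) \<and>
    (\<forall>\<psi> f. (\<psi>, f) \<in> cocycles2 L \<times> cochains1 L \<and>
            (\<Psi>, \<Phi>) = (\<psi> \<oplus>\<^sub>2 \<delta> f, \<psi> \<oplus>\<^sub>2 \<nu> f) \<longrightarrow>
      (\<forall>a\<in>tuples L d.
        H_array L (\<psi> \<oplus>\<^sub>2 \<delta> f) (\<psi> \<oplus>\<^sub>2 \<nu> f) d a =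
        H_array L \<psi> \<psi> d a * (\<Prod>j = 1..d. neg_one_pow (f (a j)))) \<and>
      hadamard_equivalent L d
        (H_array L (\<psi> \<oplus>\<^sub>2 \<delta> f) (\<psi> \<oplus>\<^sub>2 \<nu> f) d)
        (H_array L \<psi> \<psi> d))"
proof (rule conjI)
  interpret loop L by fact
  obtain \<psi> f where *: "\<psi> \<in> cocycles2 L" "f \<in> cochains1 L"
      "\<Psi> = \<psi> \<oplus>\<^sub>2 \<delta> f" "\<Phi> = \<psi> \<oplus>\<^sub>2 \<nu> f"
    using assms(4) by (rule delta_compatible_ex)
  show "\<exists>!(\<psi>, f). (\<psi>, f) \<in> cocycles2 L \<times> cochains1 L \<and>
      (\<Psi>, \<Phi>) = (\<psi> \<oplus>\<^sub>2 \<delta> f, \<psi> \<oplus>\<^sub>2 \<nu> f)"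
  proof (rule ex1I[where a = "(\<psi>, f)"], goal_cases)
    case 1
    then show ?case using * by simp
  next
    case (2 r)
    obtain \<psi>' f' where "r = (\<psi>', f')" by (cases r)
    then show ?case using 2 * delta_nu_inj[of \<psi>' \<psi> f' f] by simp
  qed
  show "\<forall>\<psi> f. (\<psi>, f) \<in> cocycles2 L \<times> cochains1 L \<and>
            (\<Psi>, \<Phi>) = (\<psi> \<oplus>\<^sub>2 \<delta> f, \<psi> \<oplus>\<^sub>2 \<nu> f) \<longrightarrow>
      (\<forall>a\<in>tuples L d.
        H_array L (\<psi> \<oplus>\<^sub>2 \<delta> f) (\<psi> \<oplus>\<^sub>2 \<nu> f) d a =
        H_array L \<psi> \<psi> d a * (\<Prod>j = 1..d. neg_one_pow (f (a j)))) \<and>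
      hadamard_equivalent L d
        (H_array L (\<psi> \<oplus>\<^sub>2 \<delta> f) (\<psi> \<oplus>\<^sub>2 \<nu> f) d)
        (H_array L \<psi> \<psi> d)"
    using H_array_add_delta_nu hadamard_equivalent_add_delta_nu assms(3) by blast
qed

end
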